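(* For $n\geq1$, $$\sum_{e\in\mathbf{I}_n(\geq,\neq,\geq)}s^{\mathrm{ROW}(e)}t^{\mathrm{ASC}(e)}u^{e_n}=\sum_{e\in\mathbf{I}_n(>,-,\geq)}s^{\mathrm{ROW}(e)}t^{\mathrm{ASC}(e)}u^{e_n}.$$
   Context: $\mathbf{I}_n=\{(e_1,\ldots,e_n): 0\leq e_i<i\}$. $\mathbf{I}_n(\geq,\neq,\geq)$ is the set of $e\in\mathbf{I}_n$ with no $i<j<k$ such that $e_i\geq e_j$, $e_j\neq e_k$ and $e_i\geq e_k$. $\mathbf{I}_n(>,-,\geq)$ is the set of $e\in\mathbf{I}_n$ with no $i<j<k$ such that $e_i>e_j$ and $e_i\geq e_k$. $\mathrm{ROW}(e)=\{e_1,\ldots,e_n\}\setminus\{0\}$, $\mathrm{ASC}(e)=\{i\in[n-1]: e_i<e_{i+1}\}$, and for a finite set $S$ of positive integers, $s^S=\prod_{i\in S}s_i$ and $t^S=\prod_{i\in S}t_i$ (commuting variables). *)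

theory Defs
  imports Main "HOL-Library.Poly_Mapping"
begin

text \<open>Sequences \<open>(e\<^sub>1, \<dots>, e\<^sub>n)\<close> are lists; \<open>ent e i\<close> is the entry \<open>e\<^sub>i\<close> with the usual index
  origin 1, so it is meaningful only for \<open>1 \<le> i \<le> length e\<close>.\<close>

definition ent :: "nat list \<Rightarrow> nat \<Rightarrow> nat" where
  "ent e i = e ! (i - 1)"

definition inv_seqs :: "nat \<Rightarrow> nat list set" where
  "inv_seqs n = {e. length e = n \<and> (\<forall>i\<in>{1..n}. ent e i < i)}"

definition inv_seqs_avoiding ::
  "nat \<Rightarrow> (nat \<Rightarrow> nat \<Rightarrow> bool) \<Rightarrow> (nat \<Rightarrow> nat \<Rightarrow> bool) \<Rightarrow> (nat \<Rightarrow> nat \<Rightarrow> bool) \<Rightarrow> nat list set" where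
  "inv_seqs_avoiding n R1 R2 R3 =
    {e \<in> inv_seqs n. \<not> (\<exists>i j k. 1 \<le> i \<and> i < j \<and> j < k \<and> k \<le> n \<and>
       R1 (ent e i) (ent e j) \<and> R2 (ent e j) (ent e k) \<and> R3 (ent e i) (ent e k))}"

text \<open>The placeholder \<open>-\<close> in a pattern is the relation that always holds.\<close>

abbreviation any_rel :: "nat \<Rightarrow> nat \<Rightarrow> bool" where
  "any_rel \<equiv> \<lambda>_ _. True"

definition ROW :: "nat list \<Rightarrow> nat set" where
  "ROW e = set e - {0}"

definition ASC :: "nat list \<Rightarrow> nat set" where
  "ASC e = {i. 1 \<le> i \<and> i < length e \<and> ent e i < ent e (i + 1)}"

text \<open>Polynomials over the integers in the commuting indeterminates \<open>s\<^sub>i\<close>, \<open>t\<^sub>i\<close> (\<open>i \<in> \<nat>\<close>) and \<open>u\<close>: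
  a monomial is a finitely supported exponent vector, a polynomial a finitely supported
  coefficient function on monomials, multiplied by convolution.\<close>

datatype indet = S nat | T nat | U

type_synonym mpoly = "(indet \<Rightarrow>\<^sub>0 nat) \<Rightarrow>\<^sub>0 int"

definition Var :: "indet \<Rightarrow> mpoly" where
  "Var x = Poly_Mapping.single (Poly_Mapping.single x 1) 1"

definition s_pow :: "nat set \<Rightarrow> mpoly" where
  "s_pow A = (\<Prod>i\<in>A. Var (S i))"

definition t_pow :: "nat set \<Rightarrow> mpoly" where
  "t_pow A = (\<Prod>i\<in>A. Var (T i))"

lemma finite_inv_seqs: "finite (inv_seqs n)"
proof (rule finite_subset)
  show "inv_seqs n \<subseteq> {e. set e \<subseteq> {..<n} \<and> length e = n}"
  proof
    fix e assume e: "e \<in> inv_seqs n"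
    have "e ! i < n" if "i < n" for i
    proof -
      have "ent e (Suc i) < Suc i"
        using e that by (auto simp: inv_seqs_def)
      then show ?thesis using that by (simp add: ent_def)
    qed
    then show "e \<in> {e. set e \<subseteq> {..<n} \<and> length e = n}"
      using e by (auto simp: inv_seqs_def in_set_conv_nth)
  qed
  show "finite {e. set e \<subseteq> {..<n} \<and> length e = n}"
    by (rule finite_lists_length_eq) simp
qed

end

theory Submission imports Defs begin

text \<open>
  Build the sequences from left to right. For either pattern, the future of a prefix depends only
  on its length, its set of values, its ascents, its last entry and the set of values that do not
  complete a forbidden pattern. With \<open>M\<close> the maximum of the prefix, a sequence avoiding
  \<open>(\<ge>,\<noteq>,\<ge>)\<close> alternates between strictly increasing runs of new maxima and plateaus; a plateau
  repeats the value of the previous one or takes a value in \<open>(m, M]\<close>, where \<open>m\<close> is the maximum at the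
  previous plateau. A sequence avoiding \<open>(>,-,\<ge>)\<close> has plateaus of value \<open>M\<close> whose last entry may
  drop to a value in \<open>(m, M)\<close>, where \<open>m\<close> is the maximum at the previous drop. The two families of
  generating functions of completions are matched by three linear identities proved
  simultaneously by induction on the number of missing entries.
\<close>

section \<open>Growing avoiding sequences entry by entry\<close>

text \<open>The bound by position is left out: it grows with the length, whereas this set can only
  shrink as the prefix is extended. It is imposed separately as \<open>{..p}\<close>.\<close>

definition admissible ::
  "(nat \<Rightarrow> nat \<Rightarrow> bool) \<Rightarrow> (nat \<Rightarrow> nat \<Rightarrow> bool) \<Rightarrow> (nat \<Rightarrow> nat \<Rightarrow> bool) \<Rightarrow> nat list \<Rightarrow> nat set" where
  "admissible R1 R2 R3 w =
    {v. \<forall>j<length w. \<forall>i<j. \<not> (R1 (w ! i) (w ! j) \<and> R2 (w ! j) v \<and> R3 (w ! i) v)}"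

text \<open>The new conditions are those with \<open>v\<close> in the middle. Its left partner can
  be any earlier entry, so only the set of values matters and positions can be forgotten.\<close>

lemma admissible_snoc:
  "admissible R1 R2 R3 (w @ [v]) =
    admissible R1 R2 R3 w \<inter> {u. \<forall>x\<in>set w. \<not> (R1 x v \<and> R2 v u \<and> R3 x u)}"
  by (auto simp: admissible_def nth_append All_less_Suc all_set_conv_all_nth)

lemma ASC_snoc:
  assumes "w \<noteq> []"
  shows "ASC (w @ [v]) = (if last w < v then insert (length w) (ASC w) else ASC w)"
  using assms by (auto simp: ASC_def ent_def nth_append less_Suc_eq last_conv_nth)

text \<open>Index origin 0 and the largest index outermost: at length \<open>Suc p\<close>,
  \<open>All_less_Suc\<close> then isolates the conditions with the last entry in third
  place.\<close>

lemma inv_seqs_avoiding_altdef: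
  "inv_seqs_avoiding n R1 R2 R3 =
    {e. length e = n \<and> (\<forall>i<n. e ! i \<le> i) \<and>
      (\<forall>k<n. \<forall>j<k. \<forall>i<j. \<not> (R1 (e ! i) (e ! j) \<and> R2 (e ! j) (e ! k) \<and> R3 (e ! i) (e ! k)))}"
    (is "_ = ?rhs")
proof (intro set_eqI iffI)
  fix e assume e: "e \<in> inv_seqs_avoiding n R1 R2 R3"
  have "e ! i \<le> i" if "i < n" for i
  proof -
    have "ent e (Suc i) < Suc i"
      using e that by (auto simp: inv_seqs_avoiding_def inv_seqs_def)
    then show ?thesis by (simp add: ent_def)
  qed
  moreover have "\<not> (R1 (e ! i) (e ! j) \<and> R2 (e ! j) (e ! k) \<and> R3 (e ! i) (e ! k))"
    if "k < n" "j < k" "i < j" for i j k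
  proof
    assume "R1 (e ! i) (e ! j) \<and> R2 (e ! j) (e ! k) \<and> R3 (e ! i) (e ! k)"
    then have "1 \<le> Suc i \<and> Suc i < Suc j \<and> Suc j < Suc k \<and> Suc k \<le> n \<and>
        R1 (ent e (Suc i)) (ent e (Suc j)) \<and> R2 (ent e (Suc j)) (ent e (Suc k)) \<and>
        R3 (ent e (Suc i)) (ent e (Suc k))"
      using that by (simp add: ent_def)
    then show False using e unfolding inv_seqs_avoiding_def by blast
  qed
  ultimately show "e \<in> ?rhs"
    using e by (simp add: inv_seqs_avoiding_def inv_seqs_def)
next
  fix e assume e: "e \<in> ?rhs"
  have "ent e i < i" if "i \<in> {1..n}" for i
  proof -
    have "e ! (i - 1) \<le> i - 1" using e that by auto
    then show ?thesis using that by (auto simp: ent_def)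
  qed
  moreover have "\<not> (R1 (ent e i) (ent e j) \<and> R2 (ent e j) (ent e k) \<and> R3 (ent e i) (ent e k))"
    if "1 \<le> i" "i < j" "j < k" "k \<le> n" for i j k
  proof -
    have "k - 1 < n" "j - 1 < k - 1" "i - 1 < j - 1" using that by auto
    then show ?thesis using e unfolding ent_def by blast
  qed
  ultimately show "e \<in> inv_seqs_avoiding n R1 R2 R3"
    using e by (auto simp: inv_seqs_avoiding_def inv_seqs_def)
qed

lemma snoc_in_inv_seqs_avoiding_iff:
  "w @ [v] \<in> inv_seqs_avoiding (Suc p) R1 R2 R3 \<longleftrightarrow>
    w \<in> inv_seqs_avoiding p R1 R2 R3 \<and> v \<in> admissible R1 R2 R3 w \<inter> {..p}"
proof (cases "length w = p")
  case True
  then show ?thesis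
    by (auto simp: inv_seqs_avoiding_altdef admissible_def nth_append All_less_Suc)
next
  case False
  then show ?thesis by (simp add: inv_seqs_avoiding_altdef)
qed

lemma inv_seqs_avoiding_Suc:
  "inv_seqs_avoiding (Suc p) R1 R2 R3 =
    (\<lambda>(w, v). w @ [v]) `
      (SIGMA w:inv_seqs_avoiding p R1 R2 R3. admissible R1 R2 R3 w \<inter> {..p})" (is "?l = ?r")
proof
  show "?l \<subseteq> ?r"
  proof
    fix e assume e: "e \<in> ?l"
    then have "length e = Suc p" by (simp add: inv_seqs_avoiding_altdef)
    then obtain w v where "e = w @ [v]" by (metis append_butlast_last_id list.size(3) nat.distinct(1))
    then show "e \<in> ?r" using e by (force simp: snoc_in_inv_seqs_avoiding_iff)
  qed
  show "?r \<subseteq> ?l" by (auto simp: snoc_in_inv_seqs_avoiding_iff)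
qed

lemma inv_seqs_avoiding_Suc_0: "inv_seqs_avoiding (Suc 0) R1 R2 R3 = {[0]}"
  by (auto simp: inv_seqs_avoiding_altdef length_Suc_conv)

lemma finite_inv_seqs_avoiding: "finite (inv_seqs_avoiding n R1 R2 R3)"
  by (rule finite_subset[OF _ finite_inv_seqs[of n]]) (auto simp: inv_seqs_avoiding_def)

text \<open>The sum of \<open>\<phi>\<close> over all ways to append \<open>k\<close> entries to a prefix of length \<open>p\<close> with set of
  values \<open>V\<close>, ascent set \<open>A\<close>, last entry \<open>l\<close> and admissible next values \<open>Q\<close>.\<close>

primrec ext_sum ::
  "(nat \<Rightarrow> nat \<Rightarrow> bool) \<Rightarrow> (nat \<Rightarrow> nat \<Rightarrow> bool) \<Rightarrow> (nat \<Rightarrow> nat \<Rightarrow> bool) \<Rightarrow>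
    (nat set \<Rightarrow> nat set \<Rightarrow> nat \<Rightarrow> 'a::comm_monoid_add) \<Rightarrow>
    nat \<Rightarrow> nat \<Rightarrow> nat set \<Rightarrow> nat set \<Rightarrow> nat \<Rightarrow> nat set \<Rightarrow> 'a" where
  "ext_sum R1 R2 R3 \<phi> 0 p V A l Q = \<phi> V A l"
| "ext_sum R1 R2 R3 \<phi> (Suc k) p V A l Q =
    (\<Sum>v\<in>Q \<inter> {..p}. ext_sum R1 R2 R3 \<phi> k (Suc p) (insert v V) (if l < v then insert p A else A) v
      (Q \<inter> {u. \<forall>x\<in>V. \<not> (R1 x v \<and> R2 v u \<and> R3 x u)}))"

declare ext_sum.simps(2) [simp del]

text \<open>Induction with \<open>p\<close> free: the hypothesis at \<open>Suc p\<close> cuts one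
  entry later, and the last entry of each such prefix is then summed out.\<close>

lemma sum_inv_seqs_avoiding_eq_ext_sum:
  fixes \<phi> :: "nat set \<Rightarrow> nat set \<Rightarrow> nat \<Rightarrow> 'a::comm_monoid_add"
  assumes "p \<ge> 1"
  shows "(\<Sum>e\<in>inv_seqs_avoiding (p + k) R1 R2 R3. \<phi> (set e) (ASC e) (last e)) =
    (\<Sum>w\<in>inv_seqs_avoiding p R1 R2 R3.
      ext_sum R1 R2 R3 \<phi> k p (set w) (ASC w) (last w) (admissible R1 R2 R3 w))"
  using assms
proof (induction k arbitrary: p)
  case 0
  then show ?case by simp
next
  case (Suc k)
  have inj: "inj_on (\<lambda>(w, v). w @ [v])
      (SIGMA w:inv_seqs_avoiding p R1 R2 R3. admissible R1 R2 R3 w \<inter> {..p})"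
    by (auto simp: inj_on_def)
  have "(\<Sum>e\<in>inv_seqs_avoiding (p + Suc k) R1 R2 R3. \<phi> (set e) (ASC e) (last e)) =
      (\<Sum>w\<in>inv_seqs_avoiding (Suc p) R1 R2 R3.
        ext_sum R1 R2 R3 \<phi> k (Suc p) (set w) (ASC w) (last w) (admissible R1 R2 R3 w))"
    using Suc.IH[of "Suc p"] by simp
  also have "\<dots> = (\<Sum>w\<in>inv_seqs_avoiding p R1 R2 R3. \<Sum>v\<in>admissible R1 R2 R3 w \<inter> {..p}.
        ext_sum R1 R2 R3 \<phi> k (Suc p) (set (w @ [v])) (ASC (w @ [v])) (last (w @ [v]))
          (admissible R1 R2 R3 (w @ [v])))"
    unfolding inv_seqs_avoiding_Suc sum.reindex[OF inj]
    by (subst sum.Sigma) (simp_all add: finite_inv_seqs_avoiding case_prod_unfold)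
  also have "\<dots> = (\<Sum>w\<in>inv_seqs_avoiding p R1 R2 R3.
      ext_sum R1 R2 R3 \<phi> (Suc k) p (set w) (ASC w) (last w) (admissible R1 R2 R3 w))"
  proof (rule sum.cong[OF refl])
    fix w assume "w \<in> inv_seqs_avoiding p R1 R2 R3"
    then have "length w = p" by (simp add: inv_seqs_avoiding_altdef)
    moreover from this have "w \<noteq> []" using Suc.prems by auto
    ultimately show "(\<Sum>v\<in>admissible R1 R2 R3 w \<inter> {..p}.
        ext_sum R1 R2 R3 \<phi> k (Suc p) (set (w @ [v])) (ASC (w @ [v])) (last (w @ [v]))
          (admissible R1 R2 R3 (w @ [v]))) =
      ext_sum R1 R2 R3 \<phi> (Suc k) p (set w) (ASC w) (last w) (admissible R1 R2 R3 w)"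
      by (simp add: ASC_snoc admissible_snoc ext_sum.simps(2) cong: if_cong)
  qed
  finally show ?case .
qed

section \<open>One-step recursions for the two patterns\<close>

abbreviation "ext_sum_A \<equiv> ext_sum (\<ge>) (\<noteq>) (\<ge>)"
abbreviation "ext_sum_B \<equiv> ext_sum (>) any_rel (\<ge>)"

context
  fixes \<phi> :: "nat set \<Rightarrow> nat set \<Rightarrow> nat \<Rightarrow> 'a::comm_monoid_add"
    and p M :: nat and V :: "nat set"
  assumes max: "M \<in> V" "\<And>x. x \<in> V \<Longrightarrow> x \<le> M" and Mp: "M < p"
begin

text \<open>\<open>C\<close> holds a plateau value still open for repetition; below it is empty or a
  singleton. After \<open>v \<le> M\<close>, the earlier entry \<open>M\<close> rules out every
  later value up to \<open>M\<close> except \<open>v\<close>; a larger \<open>v\<close> rules out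
  nothing.\<close>

lemma ext_sum_A_increasing:
  assumes "a \<le> M" "C \<subseteq> {..<a}"
  shows "ext_sum_A \<phi> (Suc k) p V A M (C \<union> {a..}) =
    (\<Sum>v\<in>C. ext_sum_A \<phi> k (Suc p) (insert v V) A v (insert v {M<..})) +
    (\<Sum>v=a..M. ext_sum_A \<phi> k (Suc p) (insert v V) A v (insert v {M<..})) +
    (\<Sum>v\<in>{M<..p}. ext_sum_A \<phi> k (Suc p) (insert v V) (insert p A) v (C \<union> {a..}))"
proof -
  let ?f = "\<lambda>v. ext_sum_A \<phi> k (Suc p) (insert v V) (if M < v then insert p A else A) v
      ((C \<union> {a..}) \<inter> {u. \<forall>x\<in>V. \<not> (v \<le> x \<and> v \<noteq> u \<and> u \<le> x)})"
  \<comment> \<open>As \<open>M < p\<close>, the bound by position cuts off only new maxima.\<close>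
  have split: "(C \<union> {a..}) \<inter> {..p} = (C \<union> {a..M}) \<union> {M<..p}"
    using assms Mp by auto
  have fin: "finite C" using assms(2) finite_subset by blast
  have low: "(C \<union> {a..}) \<inter> {u. \<forall>x\<in>V. \<not> (v \<le> x \<and> v \<noteq> u \<and> u \<le> x)} = insert v {M<..}"
    if "v \<in> C \<union> {a..M}" for v
  proof -
    have "v \<le> M" using that assms by auto
    then have "(\<forall>x\<in>V. \<not> (v \<le> x \<and> v \<noteq> u \<and> u \<le> x)) \<longleftrightarrow> u = v \<or> M < u" for u
      using max by (metis le_trans not_le)
    then show ?thesis using that assms by auto
  qed
  have high: "(C \<union> {a..}) \<inter> {u. \<forall>x\<in>V. \<not> (v \<le> x \<and> v \<noteq> u \<and> u \<le> x)} = C \<union> {a..}"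
    if "v \<in> {M<..p}" for v
    using that max(2) by fastforce
  have "ext_sum_A \<phi> (Suc k) p V A M (C \<union> {a..}) = sum ?f (C \<union> {a..M}) + sum ?f {M<..p}"
    unfolding ext_sum.simps(2) split
    using assms fin by (intro sum.union_disjoint) auto
  also have "sum ?f (C \<union> {a..M}) = sum ?f C + sum ?f {a..M}"
    using assms fin by (intro sum.union_disjoint) auto
  also have "sum ?f C = (\<Sum>v\<in>C. ext_sum_A \<phi> k (Suc p) (insert v V) A v (insert v {M<..}))"
    using assms by (intro sum.cong refl) (subst low, auto)
  also have "sum ?f {a..M} = (\<Sum>v=a..M. ext_sum_A \<phi> k (Suc p) (insert v V) A v (insert v {M<..}))"
    using assms by (intro sum.cong refl) (subst low, auto)
  also have "sum ?f {M<..p} =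
      (\<Sum>v\<in>{M<..p}. ext_sum_A \<phi> k (Suc p) (insert v V) (insert p A) v (C \<union> {a..}))"
    by (intro sum.cong refl) (subst high, auto)
  finally show ?thesis .
qed

text \<open>Repeating \<open>c\<close> changes only the length. Any other choice is a new maximum,
  after which \<open>c\<close> stays available for a later plateau.\<close>

lemma ext_sum_A_plateau:
  assumes "c \<in> V"
  shows "ext_sum_A \<phi> (Suc k) p V A c (insert c {M<..}) =
    ext_sum_A \<phi> k (Suc p) V A c (insert c {M<..}) +
    (\<Sum>v\<in>{M<..p}. ext_sum_A \<phi> k (Suc p) (insert v V) (insert p A) v (insert c {M<..}))"
proof -
  let ?f = "\<lambda>v. ext_sum_A \<phi> k (Suc p) (insert v V) (if c < v then insert p A else A) v
      (insert c {M<..} \<inter> {u. \<forall>x\<in>V. \<not> (v \<le> x \<and> v \<noteq> u \<and> u \<le> x)})"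
  have cM: "c \<le> M" using assms max by simp
  have split: "insert c {M<..} \<inter> {..p} = insert c {M<..p}" using cM Mp by auto
  have low: "insert c {M<..} \<inter> {u. \<forall>x\<in>V. \<not> (c \<le> x \<and> c \<noteq> u \<and> u \<le> x)} = insert c {M<..}"
    using max(2) by fastforce
  have high: "insert c {M<..} \<inter> {u. \<forall>x\<in>V. \<not> (v \<le> x \<and> v \<noteq> u \<and> u \<le> x)} = insert c {M<..}"
    if "v \<in> {M<..p}" for v
    using that max(2) by fastforce
  have "ext_sum_A \<phi> (Suc k) p V A c (insert c {M<..}) = ?f c + sum ?f {M<..p}"
    unfolding ext_sum.simps(2) split using cM by (intro sum.insert) auto
  also have "?f c = ext_sum_A \<phi> k (Suc p) V A c (insert c {M<..})"
    using assms by (simp only: low) (simp add: insert_absorb)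
  also have "sum ?f {M<..p} =
      (\<Sum>v\<in>{M<..p}. ext_sum_A \<phi> k (Suc p) (insert v V) (insert p A) v (insert c {M<..}))"
    using cM by (intro sum.cong refl) (subst high, auto)
  finally show ?thesis .
qed

text \<open>If \<open>v < M\<close>, the pair \<open>M\<close>, \<open>v\<close> forbids everything
  up to \<open>M\<close>: a drop. If \<open>v = M\<close>, only the length changes; a larger
  \<open>v\<close> adds no restriction.\<close>

lemma ext_sum_B_increasing:
  assumes "a \<le> M"
  shows "ext_sum_B \<phi> (Suc k) p V A M {a..} =
    (\<Sum>v=a..<M. ext_sum_B \<phi> k (Suc p) (insert v V) A v {M<..}) +
    ext_sum_B \<phi> k (Suc p) V A M {a..} +
    (\<Sum>v\<in>{M<..p}. ext_sum_B \<phi> k (Suc p) (insert v V) (insert p A) v {a..})"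
proof -
  let ?f = "\<lambda>v. ext_sum_B \<phi> k (Suc p) (insert v V) (if M < v then insert p A else A) v
      ({a..} \<inter> {u. \<forall>x\<in>V. \<not> (v < x \<and> True \<and> u \<le> x)})"
  have split: "{a..} \<inter> {..p} = insert M {a..<M} \<union> {M<..p}"
    using assms Mp by auto
  have low: "{a..} \<inter> {u. \<forall>x\<in>V. \<not> (v < x \<and> True \<and> u \<le> x)} = {M<..}"
    if "v \<in> {a..<M}" for v
  proof -
    have "(\<forall>x\<in>V. \<not> (v < x \<and> True \<and> u \<le> x)) \<longleftrightarrow> M < u" for u
      using that max by (metis atLeastLessThan_iff le_trans not_le)
    then show ?thesis using assms by auto
  qed
  have high: "{a..} \<inter> {u. \<forall>x\<in>V. \<not> (v < x \<and> True \<and> u \<le> x)} = {a..}"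
    if "v \<ge> M" for v
    using that max(2) by fastforce
  have "ext_sum_B \<phi> (Suc k) p V A M {a..} = sum ?f (insert M {a..<M}) + sum ?f {M<..p}"
    unfolding ext_sum.simps(2) split using assms by (intro sum.union_disjoint) auto
  also have "sum ?f (insert M {a..<M}) = sum ?f {a..<M} + ?f M"
    by (subst sum.insert) (auto simp: add.commute)
  also have "sum ?f {a..<M} = (\<Sum>v=a..<M. ext_sum_B \<phi> k (Suc p) (insert v V) A v {M<..})"
    by (intro sum.cong refl) (subst low, auto)
  also have "?f M = ext_sum_B \<phi> k (Suc p) V A M {a..}"
    using max by (simp only: high) (simp add: insert_absorb)
  also have "sum ?f {M<..p} =
      (\<Sum>v\<in>{M<..p}. ext_sum_B \<phi> k (Suc p) (insert v V) (insert p A) v {a..})"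
    by (intro sum.cong refl) (subst high, auto)
  finally show ?thesis .
qed

text \<open>No value up to \<open>M\<close> can follow a drop, so the next entry is a new maximum
  and always an ascent.\<close>

lemma ext_sum_B_dropped:
  assumes "c \<in> V"
  shows "ext_sum_B \<phi> (Suc k) p V A c {M<..} =
    (\<Sum>v\<in>{M<..p}. ext_sum_B \<phi> k (Suc p) (insert v V) (insert p A) v {M<..})"
proof -
  have cM: "c \<le> M" using assms max by simp
  have split: "{M<..} \<inter> {..p} = {M<..p}" by auto
  have high: "{M<..} \<inter> {u. \<forall>x\<in>V. \<not> (v < x \<and> True \<and> u \<le> x)} = {M<..}"
    if "v \<in> {M<..p}" for v
    using that max(2) by fastforce
  show ?thesis
    unfolding ext_sum.simps(2) split
    using cM by (intro sum.cong refl) (subst high, auto)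
qed

end

section \<open>Simultaneous induction on the three identities\<close>

lemma sum_atLeastAtMost_last:
  fixes f :: "nat \<Rightarrow> 'a::comm_monoid_add"
  shows "a \<le> b \<Longrightarrow> (\<Sum>v=a..b. f v) = f b + (\<Sum>v=a..<b. f v)"
  by (simp add: sum.last_plus)

text \<open>In the first identity the prefix ends with its maximum \<open>M\<close> and no plateau value can be
  repeated; in the second a plateau has just begun; in the third the last plateau was at
  maximum \<open>b\<close> and a larger maximum has been reached since.\<close>

lemma ext_sum_identities:
  fixes \<phi> :: "nat set \<Rightarrow> nat set \<Rightarrow> nat \<Rightarrow> 'a::comm_monoid_add"
  assumes "M \<in> V" "\<And>x. x \<in> V \<Longrightarrow> x \<le> M" "M < p" "a \<le> M"
  shows ext_sum_increasing: "ext_sum_A \<phi> k p V A M {a..} = ext_sum_B \<phi> k p V A M {a..}"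
    and ext_sum_plateau: "(\<Sum>v=a..M. ext_sum_A \<phi> k p (insert v V) A v (insert v {M<..})) =
      ext_sum_B \<phi> k p V A M {a..} + (\<Sum>v=a..<M. ext_sum_B \<phi> k p (insert v V) A v {M<..})"
    and ext_sum_after_plateau: "\<And>b. a \<le> b \<Longrightarrow> b < M \<Longrightarrow> b \<in> V \<Longrightarrow>
      (\<Sum>c=a..b. ext_sum_A \<phi> k p (insert c V) A M (insert c {b<..})) =
      ext_sum_B \<phi> k p V A M {a..} + (\<Sum>d=a..<b. ext_sum_B \<phi> k p (insert d V) A M {b<..})"
  using assms
proof (induction k arbitrary: p V A M a)
  case 0
  {
    case 1
    show ?case by simp
  next
    case 2
    \<comment> \<open>The top index already lies in \<open>V\<close>, so its term is the leading
      term on the right; the other terms agree one by one.\<close>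
    then show ?case by (simp add: sum_atLeastAtMost_last insert_absorb)
  next
    case (3 b)
    then show ?case by (simp add: sum_atLeastAtMost_last insert_absorb)
  }
next
  case (Suc k)
  have incr: "ext_sum_A \<phi> (Suc k) p V A M {a..} = ext_sum_B \<phi> (Suc k) p V A M {a..}"
    if h: "M \<in> V" "\<And>x. x \<in> V \<Longrightarrow> x \<le> M" "M < p" "a \<le> M" for p V A M a
  proof -
    \<comment> \<open>Entries up to \<open>M\<close> open a plateau (second identity); new maxima
      preserve the form of the first.\<close>
    have "ext_sum_A \<phi> (Suc k) p V A M {a..} =
      (\<Sum>v=a..M. ext_sum_A \<phi> k (Suc p) (insert v V) A v (insert v {M<..})) +
      (\<Sum>v\<in>{M<..p}. ext_sum_A \<phi> k (Suc p) (insert v V) (insert p A) v {a..})"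
      using ext_sum_A_increasing[OF h(1,2,3,4), where C = "{}" and \<phi> = \<phi> and k = k and A = A] by simp
    also have "(\<Sum>v=a..M. ext_sum_A \<phi> k (Suc p) (insert v V) A v (insert v {M<..})) =
        ext_sum_B \<phi> k (Suc p) V A M {a..} +
        (\<Sum>v=a..<M. ext_sum_B \<phi> k (Suc p) (insert v V) A v {M<..})"
      using h by (intro Suc.IH(2)) auto
    also have "(\<Sum>v\<in>{M<..p}. ext_sum_A \<phi> k (Suc p) (insert v V) (insert p A) v {a..}) =
        (\<Sum>v\<in>{M<..p}. ext_sum_B \<phi> k (Suc p) (insert v V) (insert p A) v {a..})"
      using h by (intro sum.cong refl Suc.IH(1)) (auto dest: h(2))
    finally show ?thesis
      using ext_sum_B_increasing[OF h, where \<phi> = \<phi> and k = k and A = A] by (simp add: ac_simps)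
  qed
  {
    case 1
    then show ?case by (rule incr)
  next
    case 2
    note h = 2
    have "(\<Sum>c=a..M. ext_sum_A \<phi> (Suc k) p (insert c V) A c (insert c {M<..})) =
      (\<Sum>c=a..M. ext_sum_A \<phi> k (Suc p) (insert c V) A c (insert c {M<..}) +
        (\<Sum>v\<in>{M<..p}.
          ext_sum_A \<phi> k (Suc p) (insert v (insert c V)) (insert p A) v (insert c {M<..})))"
      using h by (intro sum.cong refl ext_sum_A_plateau) auto
    also have "\<dots> = (\<Sum>c=a..M. ext_sum_A \<phi> k (Suc p) (insert c V) A c (insert c {M<..})) +
        (\<Sum>v\<in>{M<..p}. \<Sum>c=a..M.
          ext_sum_A \<phi> k (Suc p) (insert c (insert v V)) (insert p A) v (insert c {M<..}))"
      by (subst sum.swap[of _ "{a..M}"]) (simp add: sum.distrib insert_commute)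
    also have "(\<Sum>c=a..M. ext_sum_A \<phi> k (Suc p) (insert c V) A c (insert c {M<..})) =
        ext_sum_B \<phi> k (Suc p) V A M {a..} +
        (\<Sum>v=a..<M. ext_sum_B \<phi> k (Suc p) (insert v V) A v {M<..})"
      using h by (intro Suc.IH(2)) auto
    \<comment> \<open>The third identity applies with new maximum \<open>v\<close> and the old
      \<open>M\<close> as \<open>b\<close>; the sums were swapped to fix \<open>v\<close> while the
      plateau value \<open>c\<close> varies.\<close>
    also have "(\<Sum>v\<in>{M<..p}. \<Sum>c=a..M.
          ext_sum_A \<phi> k (Suc p) (insert c (insert v V)) (insert p A) v (insert c {M<..})) =
        (\<Sum>v\<in>{M<..p}. ext_sum_B \<phi> k (Suc p) (insert v V) (insert p A) v {a..} +
          (\<Sum>d=a..<M. ext_sum_B \<phi> k (Suc p) (insert d (insert v V)) (insert p A) v {M<..}))"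
      using h by (intro sum.cong refl Suc.IH(3)) (auto dest: h(2))
    also have "\<dots> = (\<Sum>v\<in>{M<..p}. ext_sum_B \<phi> k (Suc p) (insert v V) (insert p A) v {a..}) +
        (\<Sum>d=a..<M. \<Sum>v\<in>{M<..p}.
          ext_sum_B \<phi> k (Suc p) (insert v (insert d V)) (insert p A) v {M<..})"
      by (subst sum.swap[of _ "{M<..p}" "{a..<M}"]) (simp add: sum.distrib insert_commute)
    also have "(\<Sum>d=a..<M. \<Sum>v\<in>{M<..p}.
          ext_sum_B \<phi> k (Suc p) (insert v (insert d V)) (insert p A) v {M<..}) =
        (\<Sum>d=a..<M. ext_sum_B \<phi> (Suc k) p (insert d V) A d {M<..})"
      using h by (intro sum.cong refl ext_sum_B_dropped[symmetric]) auto
    finally show ?case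
      using ext_sum_B_increasing[OF h, where \<phi> = \<phi> and k = k and A = A] by (simp add: ac_simps)
  next
    case (3 b)
    note h = 3(4-7) and b = 3(1-3)
    let ?P = "\<lambda>W v. ext_sum_A \<phi> k (Suc p) (insert v W) A v (insert v {M<..})"
    let ?N = "\<lambda>W y. ext_sum_B \<phi> k (Suc p) (insert y W) (insert p A) y"
    \<comment> \<open>The second identity trades the repeat and drop terms of the recursion for
      plateau terms of the other pattern. It is needed for \<open>V\<close> with \<open>a\<close>
      and for \<open>insert d V\<close> with \<open>Suc b\<close>.\<close>
    have B: "ext_sum_B \<phi> (Suc k) p W A M {a'..} =
        (\<Sum>v=a'..M. ?P W v) + (\<Sum>y\<in>{M<..p}. ?N W y {a'..})"
      if "M \<in> W" "\<And>x. x \<in> W \<Longrightarrow> x \<le> M" "a' \<le> M" for W a'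
    proof -
      have "(\<Sum>v=a'..M. ?P W v) = ext_sum_B \<phi> k (Suc p) W A M {a'..} +
          (\<Sum>v=a'..<M. ext_sum_B \<phi> k (Suc p) (insert v W) A v {M<..})"
        using h(3) that by (intro Suc.IH(2)) auto
      then show ?thesis
        using ext_sum_B_increasing[OF that(1,2) h(3) that(3), where \<phi> = \<phi> and k = k and A = A] by (simp add: ac_simps)
    qed
    have bS: "{b<..} = {Suc b..}" by auto
    have "(\<Sum>c=a..b. ext_sum_A \<phi> (Suc k) p (insert c V) A M (insert c {b<..})) =
      (\<Sum>c=a..b. ?P V c + (\<Sum>v=Suc b..M. ?P (insert c V) v) +
        (\<Sum>y\<in>{M<..p}.
          ext_sum_A \<phi> k (Suc p) (insert y (insert c V)) (insert p A) y (insert c {b<..})))"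
    proof (intro sum.cong refl)
      fix c assume c: "c \<in> {a..b}"
      have "ext_sum_A \<phi> (Suc k) p (insert c V) A M ({c} \<union> {Suc b..}) =
        (\<Sum>v\<in>{c}. ?P (insert c V) v) + (\<Sum>v=Suc b..M. ?P (insert c V) v) +
        (\<Sum>y\<in>{M<..p}.
          ext_sum_A \<phi> k (Suc p) (insert y (insert c V)) (insert p A) y ({c} \<union> {Suc b..}))"
        using h b c by (intro ext_sum_A_increasing) auto
      then show "ext_sum_A \<phi> (Suc k) p (insert c V) A M (insert c {b<..}) =
        ?P V c + (\<Sum>v=Suc b..M. ?P (insert c V) v) +
        (\<Sum>y\<in>{M<..p}.
          ext_sum_A \<phi> k (Suc p) (insert y (insert c V)) (insert p A) y (insert c {b<..}))"
        by (simp add: bS)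
    qed
    also have "\<dots> = (\<Sum>c=a..b. ?P V c) + (\<Sum>c=a..b. \<Sum>v=Suc b..M. ?P (insert c V) v) +
        (\<Sum>y\<in>{M<..p}. \<Sum>c=a..b.
          ext_sum_A \<phi> k (Suc p) (insert c (insert y V)) (insert p A) y (insert c {b<..}))"
      by (subst sum.swap[of _ "{a..b}" "{M<..p}"]) (simp add: sum.distrib insert_commute)
    also have "(\<Sum>y\<in>{M<..p}. \<Sum>c=a..b.
          ext_sum_A \<phi> k (Suc p) (insert c (insert y V)) (insert p A) y (insert c {b<..})) =
        (\<Sum>y\<in>{M<..p}. ?N V y {a..} +
          (\<Sum>d=a..<b. ext_sum_B \<phi> k (Suc p) (insert d (insert y V)) (insert p A) y {b<..}))"
      using h b by (intro sum.cong refl Suc.IH(3)) (auto dest: h(2))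
    also have "\<dots> = (\<Sum>y\<in>{M<..p}. ?N V y {a..}) +
        (\<Sum>d=a..<b. \<Sum>y\<in>{M<..p}. ?N (insert d V) y {b<..})"
      by (subst sum.swap[of _ "{M<..p}" "{a..<b}"]) (simp add: sum.distrib insert_commute)
    \<comment> \<open>The term \<open>c = b\<close> splits off with
      \<open>insert b V = V\<close>.\<close>
    also have "(\<Sum>c=a..b. \<Sum>v=Suc b..M. ?P (insert c V) v) =
        (\<Sum>v=Suc b..M. ?P V v) + (\<Sum>d=a..<b. \<Sum>v=Suc b..M. ?P (insert d V) v)"
      using b by (simp add: sum_atLeastAtMost_last[of a b] insert_absorb)
    finally have lhs: "(\<Sum>c=a..b. ext_sum_A \<phi> (Suc k) p (insert c V) A M (insert c {b<..})) =
      ((\<Sum>c=a..b. ?P V c) + (\<Sum>v=Suc b..M. ?P V v)) + (\<Sum>y\<in>{M<..p}. ?N V y {a..}) +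
      (\<Sum>d=a..<b. (\<Sum>v=Suc b..M. ?P (insert d V) v) + (\<Sum>y\<in>{M<..p}. ?N (insert d V) y {b<..}))"
      by (simp add: sum.distrib ac_simps)
    \<comment> \<open>Repeated plateau values up to \<open>b\<close> and fresh ones above
      \<open>b\<close> together fill \<open>{a..M}\<close>.\<close>
    have "(\<Sum>c=a..b. ?P V c) + (\<Sum>v=Suc b..M. ?P V v) = (\<Sum>c=a..M. ?P V c)"
    proof -
      have "{a..M} = {a..b} \<union> {Suc b..M}" using b by auto
      then show ?thesis by (simp only:) (rule sum.union_disjoint[symmetric], auto)
    qed
    moreover have "(\<Sum>d=a..<b. (\<Sum>v=Suc b..M. ?P (insert d V) v) +
          (\<Sum>y\<in>{M<..p}. ?N (insert d V) y {b<..})) =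
        (\<Sum>d=a..<b. ext_sum_B \<phi> (Suc k) p (insert d V) A M {b<..})"
      unfolding bS using h b by (intro sum.cong refl B[symmetric]) auto
    ultimately show ?case
      unfolding lhs using B[OF h(1,2,4)] by simp
  }
qed

section \<open>Specialisation to the polynomial weights\<close>

theorem theorem3p6:
  fixes n :: nat
  assumes "n \<ge> 1"
  shows "(\<Sum>e\<in>inv_seqs_avoiding n (\<ge>) (\<noteq>) (\<ge>). s_pow (ROW e) * t_pow (ASC e) * Var U ^ ent e n)
       = (\<Sum>e\<in>inv_seqs_avoiding n (>) any_rel (\<ge>). s_pow (ROW e) * t_pow (ASC e) * Var U ^ ent e n)"
proof -
  define \<phi> where "\<phi> V A l = s_pow (V - {0}) * t_pow A * Var U ^ l" for V A and l :: nat
  \<comment> \<open>The first entry is always 0 and forbids nothing; \<open>{0..}\<close> is all of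
    the naturals in the shape \<open>{a..}\<close>.\<close>
  have *: "(\<Sum>e\<in>inv_seqs_avoiding n R1 R2 R3. s_pow (ROW e) * t_pow (ASC e) * Var U ^ ent e n) =
      ext_sum R1 R2 R3 \<phi> (n - 1) 1 {0} {} 0 {0..}" for R1 R2 R3
  proof -
    have "ent e n = last e" if "e \<in> inv_seqs_avoiding n R1 R2 R3" for e
    proof -
      have "length e = n" using that by (simp add: inv_seqs_avoiding_altdef)
      moreover from this have "e \<noteq> []" using assms by auto
      ultimately show ?thesis by (simp add: ent_def last_conv_nth)
    qed
    then have "(\<Sum>e\<in>inv_seqs_avoiding n R1 R2 R3.
          s_pow (ROW e) * t_pow (ASC e) * Var U ^ ent e n) =
        (\<Sum>e\<in>inv_seqs_avoiding (1 + (n - 1)) R1 R2 R3. \<phi> (set e) (ASC e) (last e))"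
      using assms by (simp add: \<phi>_def ROW_def)
    also have "\<dots> = ext_sum R1 R2 R3 \<phi> (n - 1) 1 {0} (ASC [0]) 0 (admissible R1 R2 R3 [0])"
      by (subst sum_inv_seqs_avoiding_eq_ext_sum) (simp_all add: inv_seqs_avoiding_Suc_0)
    also have "ASC [0] = {}" by (simp add: ASC_def)
    also have "admissible R1 R2 R3 [0] = {0..}" by (auto simp: admissible_def)
    finally show ?thesis .
  qed
  show ?thesis
    \<comment> \<open>The first identity at \<open>M = 0\<close>, \<open>a = 0\<close>,
      \<open>p = 1\<close>.\<close>
    unfolding * by (rule ext_sum_increasing) auto
qed

end
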